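(* Let $n$ be a positive integer, let $r \in \mathbb{R}_+[x_1,\dots,x_n]$ be a polynomial with nonnegative coefficients such that $\mathrm{Log}(r) \supseteq \mathbb{N}^n_1$, and let $f \in \mathbb{R}[x_1,\dots,x_n]$. Then the following statements are equivalent: (a) $f > 0$ on $\{r = 1\}_+$, i.e. $f(x)>0$ for every $x \in \{r=1\}_+$. (b) There exists some $N_o \in \mathbb{N}$ such that for all integers $N \ge N_o$ there exists some $q_N \in \mathbb{R}_+[x_1,\dots,x_n]$ with $\mathrm{Log}(q_N) = \bigcup_{d=0}^N d\,\mathrm{Log}(r)$ such that $f \equiv q_N \pmod{r-1}$. (c) There exist some $N \in \mathbb{N}$ and some $q_N \in \mathbb{R}_+[x_1,\dots,x_n]$ with $\mathrm{Log}(q_N) = \bigcup_{d=0}^N d\,\mathrm{Log}(r)$ such that $f \equiv q_N \pmod{r-1}$.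
   Context: $\mathbb{N}$ denotes the set of nonnegative integers and $\mathbb{R}_+$ the set of nonnegative real numbers. $\mathbb{R}_+[x_1,\dots,x_n] \subseteq \mathbb{R}[x_1,\dots,x_n]$ is the set of real polynomials all of whose coefficients are nonnegative. For $\alpha=(\alpha_1,\dots,\alpha_n) \in \mathbb{N}^n$, $x^\alpha := x_1^{\alpha_1}\cdots x_n^{\alpha_n}$. For $p = \sum_{\alpha \in \mathbb{N}^n} a_\alpha x^\alpha \in \mathbb{R}_+[x_1,\dots,x_n]$, $\mathrm{Log}(p) := \{\alpha \in \mathbb{N}^n : a_\alpha > 0\}$. $\mathbb{N}^n_1 := \{(1,0,\dots,0),(0,1,0,\dots,0),\dots,(0,\dots,0,1)\} \subset \mathbb{N}^n$ is the set of standard unit vectors. For $J \subseteq \mathbb{N}^n$ and $d \in \mathbb{N}$, $dJ := J + \cdots + J$ ($d$ times) is the $d$-fold Minkowski sum of $J$ with itself; in particular $0J = \{(0,\dots,0)\}$. $\{r=1\}_+ := \{x=(x_1,\dots,x_n) \in \mathbb{R}^n : r(x) = 1 \text{ and } x_1,\dots,x_n \ge 0\}$. For polynomials $f,g,h \in \mathbb{R}[x_1,\dots,x_n]$, $f \equiv g \pmod{h}$ means that $f-g$ is divisible by $h$ in $\mathbb{R}[x_1,\dots,x_n]$. *)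

theory Defs
  imports "HOL-Analysis.Analysis" "HOL-Library.Poly_Mapping" "HOL-Library.Set_Algebras"
begin

text \<open>
  Real polynomials in variables indexed by a finite type \<open>'n\<close>: finitely supported maps from
  exponent vectors \<open>'n \<Rightarrow>\<^sub>0 nat\<close> to coefficients, with the convolution product of
  \<^theory>\<open>HOL-Library.Poly_Mapping\<close>. As \<open>'n\<close> ranges over the finite types, the number of
  variables ranges over the positive integers.
\<close>

type_synonym 'n rpoly = "('n \<Rightarrow>\<^sub>0 nat) \<Rightarrow>\<^sub>0 real"

definition monom_eval :: "('n::finite \<Rightarrow>\<^sub>0 nat) \<Rightarrow> real ^ 'n \<Rightarrow> real" where
  "monom_eval \<alpha> x = (\<Prod>i\<in>UNIV. (x $ i) ^ Poly_Mapping.lookup \<alpha> i)"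

definition poly_eval :: "'n::finite rpoly \<Rightarrow> real ^ 'n \<Rightarrow> real" where
  "poly_eval p x = (\<Sum>\<alpha>\<in>Poly_Mapping.keys p. Poly_Mapping.lookup p \<alpha> * monom_eval \<alpha> x)"

definition nonneg_rpoly :: "'n rpoly set" where
  "nonneg_rpoly = {p. \<forall>\<alpha>. Poly_Mapping.lookup p \<alpha> \<ge> 0}"

definition Log :: "'n rpoly \<Rightarrow> ('n \<Rightarrow>\<^sub>0 nat) set" where
  "Log p = {\<alpha>. Poly_Mapping.lookup p \<alpha> > 0}"

definition unit_exponents :: "('n \<Rightarrow>\<^sub>0 nat) set" where
  "unit_exponents = range (\<lambda>i. Poly_Mapping.single i 1)"

text \<open>
  The sum below is taken in the additive monoid of sets, i.e. it is a Minkowski sum; for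
  \<open>d = 0\<close> it is the neutral element \<open>{0}\<close>.
\<close>

definition minkowski_multiple :: "nat \<Rightarrow> 'a::comm_monoid_add set \<Rightarrow> 'a set" where
  "minkowski_multiple d J = (\<Sum>i<d. J)"

definition nonneg_level_one :: "'n::finite rpoly \<Rightarrow> (real ^ 'n) set" where
  "nonneg_level_one r = {x. poly_eval r x = 1 \<and> (\<forall>i. x $ i \<ge> 0)}"

definition poly_cong :: "'n rpoly \<Rightarrow> 'n rpoly \<Rightarrow> 'n rpoly \<Rightarrow> bool" where
  "poly_cong f g h \<longleftrightarrow> h dvd (f - g)"

end

theory Submission
  imports Defs
begin


text \<open>
  The hard direction is from positivity of \<open>f\<close> on the level set of \<open>r\<close> to a representative of
  \<open>f\<close> modulo \<open>r - 1\<close> with prescribed support. It is a Polya-type argument on a simplex, to which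
  the level set is reduced by a penalty term.
  
  Let \<open>a\<^sub>i > 0\<close> be the coefficient of \<open>x\<^sub>i\<close> in \<open>r\<close>, and let \<open>\<Delta>\<close> be the simplex given by \<open>x \<ge> 0\<close> and
  \<open>\<Sum>a\<^sub>i x\<^sub>i \<le> 1\<close>. Adding a multiple \<open>C (r - 1)\<^sup>2\<close> does not change \<open>f\<close> modulo \<open>r - 1\<close>. On \<open>\<Delta>\<close> the square
  vanishes only where \<open>r = 1\<close>, and there \<open>f\<close> is positive. So by compactness (\<open>exists_penalty\<close>) a
  large \<open>C\<close> makes \<open>f + C (r - 1)\<^sup>2\<close> exceed some \<open>\<epsilon> > 0\<close> on all of \<open>\<Delta>\<close>.
  
  A polynomial that is positive on \<open>\<Delta>\<close> is a polynomial with nonnegative coefficients in the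
  \<open>x\<^sub>i\<close> and the slack \<open>1 - \<Sum>a\<^sub>i x\<^sub>i\<close> (\<open>positive_on_simplex_imp_in_semiring\<close>). Modulo \<open>r - 1\<close> the slack is
  congruent to \<open>r - \<Sum>a\<^sub>i x\<^sub>i\<close>, which is \<open>r\<close> with its linear terms deleted and hence again has
  nonnegative coefficients (\<open>slack_cong_nonneg\<close>). Therefore \<open>f\<close> is congruent to \<open>q\<^sub>0 + \<epsilon>\<close> for some \<open>q\<^sub>0\<close> with
  nonnegative coefficients.
  
  The constant \<open>\<epsilon>\<close> pays for the support: it is congruent to \<open>\<epsilon> / (N + 1) \<cdot> (1 + r + \<dots> + r\<^sup>N)\<close>, whose
  support is exactly the required union of Minkowski multiples (\<open>const_cong_full_support\<close>). Since the
  support of \<open>r\<close> contains the unit exponents, this union contains the finite support of \<open>q\<^sub>0\<close> as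
  soon as \<open>N\<close> is large, and then adding \<open>q\<^sub>0\<close> does not enlarge it.
  
  Conversely, the union always contains the exponent \<open>0\<close>, so a representative with that support has a
  positive constant term, which bounds its values on the nonnegative orthant from below
  (\<open>positive_on_level_set\<close>).
\<close>

section \<open>Sums of single monomials\<close>

lemma poly_mapping_sum_single:
  fixes p :: "'a \<Rightarrow>\<^sub>0 'b::comm_monoid_add"
  shows "p = (\<Sum>k\<in>Poly_Mapping.keys p. Poly_Mapping.single k (Poly_Mapping.lookup p k))"
proof (rule poly_mapping_eqI)
  fix k
  show "Poly_Mapping.lookup p k = Poly_Mapping.lookup
      (\<Sum>k\<in>Poly_Mapping.keys p. Poly_Mapping.single k (Poly_Mapping.lookup p k)) k"
    by (cases "k \<in> Poly_Mapping.keys p")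
      (auto simp: lookup_sum lookup_single when_def in_keys_iff sum.delta)
qed

lemma single_sum:
  "Poly_Mapping.single k (\<Sum>i\<in>I. v i) = (\<Sum>i\<in>I. Poly_Mapping.single k (v i))"
  by (induction I rule: infinite_finite_induct) (simp_all add: single_add)

lemma poly_mapping_single_add_induct [case_names single add]:
  fixes p :: "'a \<Rightarrow>\<^sub>0 'b::comm_monoid_add"
  assumes single: "\<And>k v. P (Poly_Mapping.single k v)"
    and add: "\<And>p q. P p \<Longrightarrow> P q \<Longrightarrow> P (p + q)"
  shows "P p"
proof -
  have "P (\<Sum>k\<in>A. Poly_Mapping.single k (Poly_Mapping.lookup p k))" if "finite A" for A
    using that
  proof (induction A rule: finite_induct)
    case empty
    show ?case using single[of undefined 0] by simp
  next
    case (insert k A)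
    then show ?case by (simp add: single add)
  qed
  then show ?thesis by (subst poly_mapping_sum_single) simp
qed

section \<open>Evaluation\<close>

lemma poly_eval_single [simp]:
  "poly_eval (Poly_Mapping.single \<alpha> c) x = c * monom_eval \<alpha> x"
  by (simp add: poly_eval_def)

lemma monom_eval_0 [simp]: "monom_eval 0 x = 1"
  by (simp add: monom_eval_def)

lemma monom_eval_add: "monom_eval (\<alpha> + \<beta>) x = monom_eval \<alpha> x * monom_eval \<beta> x"
  by (simp add: monom_eval_def lookup_add power_add prod.distrib)

lemma monom_eval_single [simp]: "monom_eval (Poly_Mapping.single i 1) x = x $ i"
proof -
  have "monom_eval (Poly_Mapping.single i 1) x = (\<Prod>j\<in>UNIV. if j = i then x $ j else 1)"
    unfolding monom_eval_def by (intro prod.cong) (auto simp: lookup_single when_def)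
  then show ?thesis by simp
qed

lemma poly_eval_add: "poly_eval (p + q) x = poly_eval p x + poly_eval q x"
  unfolding poly_eval_def by (rule setsum_keys_plus_distrib) (simp_all add: distrib_right)

lemma poly_eval_mult: "poly_eval (p * q) x = poly_eval p x * poly_eval q x"
proof (induction p rule: poly_mapping_single_add_induct)
  case (single k v)
  show ?case
    by (induction q rule: poly_mapping_single_add_induct)
      (simp_all add: mult_single monom_eval_add distrib_left poly_eval_add)
qed (simp add: distrib_right poly_eval_add)

lemma poly_eval_1 [simp]: "poly_eval 1 x = 1"
  using poly_eval_single[of 0 1 x] by simp

lemma poly_eval_diff: "poly_eval (p - q) x = poly_eval p x - poly_eval q x"
  using poly_eval_add[of "p - q" q x] by simp

lemma continuous_on_poly_eval: "continuous_on A (poly_eval p)"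
  unfolding poly_eval_def monom_eval_def by (intro continuous_intros)

section \<open>Polynomials with nonnegative coefficients\<close>

lemma lookup_mult_keys:
  fixes p q :: "'n rpoly"
  shows "Poly_Mapping.lookup (p * q) \<gamma> =
    (\<Sum>(\<alpha>, \<beta>)\<in>Poly_Mapping.keys p \<times> Poly_Mapping.keys q.
      if \<alpha> + \<beta> = \<gamma> then Poly_Mapping.lookup p \<alpha> * Poly_Mapping.lookup q \<beta> else 0)"
proof -
  let ?m = "\<lambda>p \<alpha>. Poly_Mapping.single \<alpha> (Poly_Mapping.lookup p \<alpha>)"
  have "p * q = (\<Sum>\<alpha>\<in>Poly_Mapping.keys p. ?m p \<alpha>) * (\<Sum>\<beta>\<in>Poly_Mapping.keys q. ?m q \<beta>)"
    using poly_mapping_sum_single[of p] poly_mapping_sum_single[of q] by simp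
  also have "\<dots> = (\<Sum>(\<alpha>, \<beta>)\<in>Poly_Mapping.keys p \<times> Poly_Mapping.keys q.
      Poly_Mapping.single (\<alpha> + \<beta>) (Poly_Mapping.lookup p \<alpha> * Poly_Mapping.lookup q \<beta>))"
    by (simp add: sum_product sum.cartesian_product mult_single)
  finally show ?thesis
    by (simp add: lookup_sum lookup_single when_def case_prod_unfold)
qed

lemma nonneg_rpoly_add: "p \<in> nonneg_rpoly \<Longrightarrow> q \<in> nonneg_rpoly \<Longrightarrow> p + q \<in> nonneg_rpoly"
  by (simp add: nonneg_rpoly_def lookup_add)

lemma nonneg_rpoly_mult: "p \<in> nonneg_rpoly \<Longrightarrow> q \<in> nonneg_rpoly \<Longrightarrow> p * q \<in> nonneg_rpoly"
  by (auto simp: nonneg_rpoly_def lookup_mult_keys case_prod_unfold intro!: sum_nonneg)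

lemma nonneg_rpoly_single: "c \<ge> 0 \<Longrightarrow> Poly_Mapping.single \<alpha> c \<in> nonneg_rpoly"
  by (simp add: nonneg_rpoly_def lookup_single when_def)

lemma nonneg_rpoly_0 [simp]: "0 \<in> nonneg_rpoly"
  by (simp add: nonneg_rpoly_def)

lemma nonneg_rpoly_1 [simp]: "1 \<in> nonneg_rpoly"
  using nonneg_rpoly_single[of 1 0] by simp

lemma nonneg_rpoly_power: "p \<in> nonneg_rpoly \<Longrightarrow> p ^ d \<in> nonneg_rpoly"
  by (induction d) (auto intro: nonneg_rpoly_mult)

lemma nonneg_rpoly_sum:
  "(\<And>i. i \<in> I \<Longrightarrow> p i \<in> nonneg_rpoly) \<Longrightarrow> (\<Sum>i\<in>I. p i) \<in> nonneg_rpoly"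
  by (induction I rule: infinite_finite_induct) (auto intro: nonneg_rpoly_add)

lemma Log_eq_keys: "p \<in> nonneg_rpoly \<Longrightarrow> Log p = Poly_Mapping.keys p"
  by (auto simp: Log_def nonneg_rpoly_def in_keys_iff order_less_le)

lemma Log_add:
  assumes "p \<in> nonneg_rpoly" "q \<in> nonneg_rpoly"
  shows "Log (p + q) = Log p \<union> Log q"
proof (intro set_eqI)
  fix \<alpha>
  have "Poly_Mapping.lookup p \<alpha> \<ge> 0" "Poly_Mapping.lookup q \<alpha> \<ge> 0"
    using assms by (auto simp: nonneg_rpoly_def)
  then show "\<alpha> \<in> Log (p + q) \<longleftrightarrow> \<alpha> \<in> Log p \<union> Log q"
    by (auto simp: Log_def lookup_add)
qed

text \<open>
  Among nonnegative coefficients no cancellation is possible: a coefficient of the product is a sum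
  of nonnegative terms and is positive as soon as one of them is.
\<close>

lemma Log_mult:
  assumes "p \<in> nonneg_rpoly" "q \<in> nonneg_rpoly"
  shows "Log (p * q) = Log p + Log q"
proof (intro set_eqI)
  fix \<gamma>
  let ?K = "Poly_Mapping.keys p \<times> Poly_Mapping.keys q"
  let ?t = "\<lambda>(\<alpha>, \<beta>). if \<alpha> + \<beta> = \<gamma> then Poly_Mapping.lookup p \<alpha> * Poly_Mapping.lookup q \<beta> else 0"
  have nonneg: "\<And>z. z \<in> ?K \<Longrightarrow> ?t z \<ge> 0"
    using assms by (auto simp: nonneg_rpoly_def)
  have "\<gamma> \<in> Log (p * q) \<longleftrightarrow> sum ?t ?K \<noteq> 0"
    using Log_eq_keys[OF nonneg_rpoly_mult[OF assms]] by (simp add: in_keys_iff lookup_mult_keys)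
  also have "\<dots> \<longleftrightarrow> (\<exists>z\<in>?K. ?t z \<noteq> 0)"
    by (subst sum_nonneg_eq_0_iff) (use nonneg in auto)
  also have "\<dots> \<longleftrightarrow> \<gamma> \<in> Log p + Log q"
    by (auto simp: set_plus_def Log_eq_keys[OF assms(1)] Log_eq_keys[OF assms(2)] in_keys_iff)
  finally show "\<gamma> \<in> Log (p * q) \<longleftrightarrow> \<gamma> \<in> Log p + Log q" .
qed

lemma Log_single: "c > 0 \<Longrightarrow> Log (Poly_Mapping.single \<alpha> c) = {\<alpha>}"
  by (auto simp: Log_def lookup_single when_def)

lemma Log_sum:
  assumes "finite I" "\<And>i. i \<in> I \<Longrightarrow> p i \<in> nonneg_rpoly"
  shows "Log (\<Sum>i\<in>I. p i) = (\<Union>i\<in>I. Log (p i))"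
  using assms
proof (induction I rule: finite_induct)
  case (insert i I)
  then show ?case by (simp add: Log_add nonneg_rpoly_sum)
qed (simp add: Log_def)

lemma minkowski_multiple_0: "minkowski_multiple 0 J = {0}"
  by (simp add: minkowski_multiple_def set_zero)

lemma minkowski_multiple_add:
  "minkowski_multiple (c + d) J = minkowski_multiple c J + minkowski_multiple d J"
  by (induction d) (simp_all add: minkowski_multiple_def ac_simps)

lemma minkowski_multiple_1: "minkowski_multiple (Suc 0) J = J"
  by (simp add: minkowski_multiple_def)

lemma Log_power:
  assumes "r \<in> nonneg_rpoly"
  shows "Log (r ^ d) = minkowski_multiple d (Log r)"
proof (induction d)
  case 0
  show ?case using Log_single[of 1 0] by (simp add: minkowski_multiple_0)
next
  case (Suc d)
  then show ?case
    using minkowski_multiple_add[of "Suc 0" d "Log r"]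
    by (simp add: Log_mult assms nonneg_rpoly_power minkowski_multiple_1)
qed

text \<open>
  The exponents that lie in some multiple of \<open>J\<close> are closed under addition, and the unit exponents
  generate all of them.
\<close>

lemma exponent_in_minkowski_multiple:
  fixes \<alpha> :: "'n \<Rightarrow>\<^sub>0 nat"
  assumes "unit_exponents \<subseteq> J"
  shows "\<exists>d. \<alpha> \<in> minkowski_multiple d J"
proof (induction \<alpha> rule: poly_mapping_single_add_induct)
  case (single i m)
  have "Poly_Mapping.single i m \<in> minkowski_multiple m J"
  proof (induction m)
    case 0
    show ?case by (simp add: minkowski_multiple_0)
  next
    case (Suc m)
    have "Poly_Mapping.single i 1 \<in> minkowski_multiple 1 J"
      using assms by (auto simp: minkowski_multiple_1 unit_exponents_def)
    with Suc have "Poly_Mapping.single i m + Poly_Mapping.single i 1 \<in> minkowski_multiple (m + 1) J"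
      unfolding minkowski_multiple_add by (rule set_plus_intro)
    then show ?case by (simp add: single_add[symmetric])
  qed
  then show ?case ..
next
  case (add \<alpha> \<beta>)
  then obtain c d where "\<alpha> \<in> minkowski_multiple c J" "\<beta> \<in> minkowski_multiple d J" by blast
  then have "\<alpha> + \<beta> \<in> minkowski_multiple (c + d) J"
    unfolding minkowski_multiple_add by (rule set_plus_intro)
  then show ?case ..
qed

lemma finite_exponents_in_minkowski_multiples:
  fixes A :: "('n \<Rightarrow>\<^sub>0 nat) set"
  assumes "finite A" "unit_exponents \<subseteq> J"
  shows "\<exists>N\<^sub>0. \<forall>N\<ge>N\<^sub>0. A \<subseteq> (\<Union>d\<in>{0..N}. minkowski_multiple d J)"
proof -
  obtain d where d: "\<And>\<alpha>. \<alpha> \<in> minkowski_multiple (d \<alpha>) J"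
    using exponent_in_minkowski_multiple[OF assms(2)] by metis
  have "A \<subseteq> (\<Union>d\<in>{0..N}. minkowski_multiple d J)" if "N \<ge> Max (insert 0 (d ` A))" for N
  proof
    fix \<alpha> assume "\<alpha> \<in> A"
    then have "d \<alpha> \<le> N" using that assms(1) by auto
    with d[of \<alpha>] show "\<alpha> \<in> (\<Union>d\<in>{0..N}. minkowski_multiple d J)" by auto
  qed
  then show ?thesis by blast
qed


section \<open>Bernstein coefficients\<close>

text \<open>
  Fix polynomials \<open>y\<^sub>k\<close> with \<open>\<Sum>y\<^sub>k = 1\<close>. Expanding \<open>(\<Sum>y\<^sub>k)\<^sup>M\<close> writes \<open>1\<close> as the sum of the Bernstein
  polynomials \<open>M! \<cdot> \<Prod>y\<^sub>k\<^bsup>\<gamma> k\<^esup> / (\<gamma> k)!\<close> of degree \<open>M\<close>. When the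
  \<open>y\<^sub>k\<close> are the barycentric coordinates of a simplex, every polynomial is, for large \<open>M\<close>, a combination
  of these whose coefficient at \<open>\<gamma>\<close> is uniformly close to the value of the polynomial at the point with
  barycentric coordinates \<open>\<gamma> k / M\<close>; the lemmas below are the steps of an induction that shows this. Hence a polynomial that is positive on
  the simplex has positive coefficients in a sufficiently high degree.
\<close>

definition compositions :: "nat \<Rightarrow> ('k::finite \<Rightarrow> nat) set" where
  "compositions M = {\<gamma>. sum \<gamma> UNIV = M}"

text \<open>
  Dividing by the factorials, and leaving out the factor \<open>M!\<close>, makes multiplication by \<open>y\<^sub>k\<close> a shift of
  \<open>\<gamma>\<close> with the integer factor \<open>\<gamma> k + 1\<close>, independent of the degree.
\<close>

definition divided_monomial :: "('k::finite \<Rightarrow> 'n rpoly) \<Rightarrow> ('k \<Rightarrow> nat) \<Rightarrow> 'n rpoly" where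
  "divided_monomial y \<gamma> =
     Poly_Mapping.single 0 (1 / (\<Prod>k\<in>UNIV. fact (\<gamma> k))) * (\<Prod>k\<in>UNIV. y k ^ \<gamma> k)"

lemma compositions_0: "compositions 0 = {\<lambda>_. 0}"
  by (auto simp: compositions_def)

lemma composition_le: "\<gamma> \<in> compositions M \<Longrightarrow> \<gamma> k \<le> M"
  unfolding compositions_def using member_le_sum[of k UNIV \<gamma>] by auto

lemma finite_compositions: "finite (compositions M :: ('k::finite \<Rightarrow> nat) set)"
proof (rule finite_subset)
  show "compositions M \<subseteq> PiE (UNIV :: 'k set) (\<lambda>_. {..M})"
    by (auto simp: composition_le)
  show "finite (PiE (UNIV :: 'k set) (\<lambda>_. {..M}))"
    by (intro finite_PiE) auto
qed

lemma sum_fun_upd_Suc: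
  fixes \<gamma> :: "'k::finite \<Rightarrow> nat"
  shows "sum (\<gamma>(k := Suc (\<gamma> k))) UNIV = Suc (sum \<gamma> UNIV)"
  by (simp add: sum.remove[of UNIV k])

lemma mult_divided_monomial:
  "y k * divided_monomial y \<gamma> =
     Poly_Mapping.single 0 (real (Suc (\<gamma> k))) * divided_monomial y (\<gamma>(k := Suc (\<gamma> k)))"
proof -
  let ?\<delta> = "\<gamma>(k := Suc (\<gamma> k))"
  have fact: "(\<Prod>j\<in>UNIV. fact (?\<delta> j)) = real (Suc (\<gamma> k)) * (\<Prod>j\<in>UNIV. fact (\<gamma> j))"
    by (simp add: prod.remove[of UNIV k] mult.assoc del: of_nat_Suc)
  have prod: "(\<Prod>j\<in>UNIV. y j ^ ?\<delta> j) = y k * (\<Prod>j\<in>UNIV. y j ^ \<gamma> j)"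
    by (simp add: prod.remove[of UNIV k] mult.assoc)
  have "Poly_Mapping.single 0 (real (Suc (\<gamma> k))) * divided_monomial y ?\<delta> =
      Poly_Mapping.single 0 (real (Suc (\<gamma> k)) * (1 / (\<Prod>j\<in>UNIV. fact (?\<delta> j)))) *
        (\<Prod>j\<in>UNIV. y j ^ ?\<delta> j)"
    unfolding divided_monomial_def by (simp only: mult.assoc[symmetric] mult_single add_0)
  also have "real (Suc (\<gamma> k)) * (1 / (\<Prod>j\<in>UNIV. fact (?\<delta> j))) = 1 / (\<Prod>j\<in>UNIV. fact (\<gamma> j))"
    unfolding fact by (simp del: of_nat_Suc)
  finally show ?thesis
    unfolding prod divided_monomial_def by (simp only: ac_simps)
qed

text \<open>
  The one recurrence behind both the expansion of \<open>1\<close> and the approximation of products. On the right,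
  \<open>\<gamma>(k := \<gamma> k - 1)\<close> is not a composition of \<open>M\<close> when \<open>\<gamma> k = 0\<close>, but the factor \<open>\<gamma> k\<close> removes these terms.
\<close>

lemma mult_sum_divided_monomials:
  fixes y :: "'k::finite \<Rightarrow> 'n rpoly"
  shows "y k * (\<Sum>\<gamma>\<in>compositions M. Poly_Mapping.single 0 (c \<gamma>) * divided_monomial y \<gamma>) =
   (\<Sum>\<gamma>\<in>compositions (Suc M).
      Poly_Mapping.single 0 (real (\<gamma> k) * c (\<gamma>(k := \<gamma> k - 1))) * divided_monomial y \<gamma>)"
proof -
  let ?up = "\<lambda>\<gamma>. \<gamma>(k := Suc (\<gamma> k))"
  let ?t = "\<lambda>\<gamma>. Poly_Mapping.single 0 (real (\<gamma> k) * c (\<gamma>(k := \<gamma> k - 1))) * divided_monomial y \<gamma>"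
  have "y k * (\<Sum>\<gamma>\<in>compositions M. Poly_Mapping.single 0 (c \<gamma>) * divided_monomial y \<gamma>) =
      (\<Sum>\<gamma>\<in>compositions M. ?t (?up \<gamma>))"
    unfolding sum_distrib_left
  proof (intro sum.cong refl)
    fix \<gamma>
    have "y k * (Poly_Mapping.single 0 (c \<gamma>) * divided_monomial y \<gamma>) =
        Poly_Mapping.single 0 (c \<gamma>) * (y k * divided_monomial y \<gamma>)"
      by (simp only: ac_simps)
    also have "\<dots> = Poly_Mapping.single 0 (c \<gamma> * real (Suc (\<gamma> k))) * divided_monomial y (?up \<gamma>)"
      unfolding mult_divided_monomial by (simp only: mult.assoc[symmetric] mult_single add_0)
    also have "\<dots> = ?t (?up \<gamma>)"
      by (simp del: of_nat_Suc add: mult.commute)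
    finally show "y k * (Poly_Mapping.single 0 (c \<gamma>) * divided_monomial y \<gamma>) = ?t (?up \<gamma>)" .
  qed
  also have "\<dots> = (\<Sum>\<gamma>\<in>{\<gamma> \<in> compositions (Suc M). \<gamma> k \<noteq> 0}. ?t \<gamma>)"
  proof (rule sum.reindex_bij_witness[where j = ?up and i = "\<lambda>\<gamma>. \<gamma>(k := \<gamma> k - 1)"])
    fix \<gamma> :: "'k \<Rightarrow> nat" assume g: "\<gamma> \<in> {\<gamma> \<in> compositions (Suc M). \<gamma> k \<noteq> 0}"
    let ?\<delta> = "\<gamma>(k := \<gamma> k - 1)"
    show eq: "?up ?\<delta> = \<gamma>" using g by auto
    have "Suc (sum ?\<delta> UNIV) = sum \<gamma> UNIV"
      using sum_fun_upd_Suc[of ?\<delta> k] unfolding eq by simp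
    then show "?\<delta> \<in> compositions M"
      using g by (simp add: compositions_def)
  next
    fix \<gamma> :: "'k \<Rightarrow> nat" assume g: "\<gamma> \<in> compositions M"
    show "(?up \<gamma>)(k := ?up \<gamma> k - 1) = \<gamma>" by auto
    show "?up \<gamma> \<in> {\<gamma> \<in> compositions (Suc M). \<gamma> k \<noteq> 0}"
      using g sum_fun_upd_Suc[of \<gamma> k] by (simp add: compositions_def)
  qed (rule refl)
  also have "\<dots> = (\<Sum>\<gamma>\<in>compositions (Suc M). ?t \<gamma>)"
    by (rule sum.mono_neutral_left) (auto simp: finite_compositions)
  finally show ?thesis .
qed

text \<open>
  The multinomial theorem for \<open>(\<Sum>y\<^sub>k)\<^sup>M\<close>. Multiplying the identity in degree \<open>M\<close> by \<open>\<Sum>y\<^sub>k = 1\<close>, the recurrence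
  gives each \<open>\<gamma>\<close> of degree \<open>M + 1\<close> the coefficient \<open>M! \<cdot> \<Sum>\<gamma> k = (M + 1)!\<close>.
\<close>

lemma sum_divided_monomials:
  fixes y :: "'k::finite \<Rightarrow> 'n rpoly"
  assumes "sum y UNIV = 1"
  shows "(\<Sum>\<gamma>\<in>compositions M. Poly_Mapping.single 0 (fact M) * divided_monomial y \<gamma>) = 1"
proof (induction M)
  case 0
  show ?case by (simp add: compositions_0 divided_monomial_def)
next
  case (Suc M)
  have "1 = (\<Sum>k\<in>UNIV. y k * (\<Sum>\<gamma>\<in>compositions M.
      Poly_Mapping.single 0 (fact M) * divided_monomial y \<gamma>))"
    using assms by (simp add: Suc)
  also have "\<dots> = (\<Sum>k\<in>UNIV. \<Sum>\<gamma>\<in>compositions (Suc M).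
      Poly_Mapping.single 0 (real (\<gamma> k) * fact M) * divided_monomial y \<gamma>)"
    by (intro sum.cong refl) (rule mult_sum_divided_monomials[where c = "\<lambda>_. fact M"])
  also have "\<dots> = (\<Sum>\<gamma>\<in>compositions (Suc M).
      (\<Sum>k\<in>UNIV. Poly_Mapping.single 0 (real (\<gamma> k) * fact M)) * divided_monomial y \<gamma>)"
    by (subst sum.swap) (simp only: sum_distrib_right)
  also have "\<dots> = (\<Sum>\<gamma>\<in>compositions (Suc M).
      Poly_Mapping.single 0 (fact (Suc M)) * divided_monomial y \<gamma>)"
  proof (intro sum.cong refl arg_cong2[where f = "(*)"])
    fix \<gamma> :: "'k \<Rightarrow> nat" assume "\<gamma> \<in> compositions (Suc M)"
    then have g: "sum \<gamma> UNIV = Suc M" by (simp add: compositions_def)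
    have "(\<Sum>k\<in>UNIV. Poly_Mapping.single 0 (real (\<gamma> k) * fact M)) =
        Poly_Mapping.single (0 :: 'n \<Rightarrow>\<^sub>0 nat) (\<Sum>k\<in>UNIV. real (\<gamma> k) * fact M)"
      by (rule single_sum[symmetric])
    also have "(\<Sum>k\<in>UNIV. real (\<gamma> k) * fact M) = fact (Suc M)"
      using g by (simp add: sum_distrib_right[symmetric] of_nat_sum[symmetric] del: of_nat_sum of_nat_Suc)
    finally show "(\<Sum>k\<in>UNIV. Poly_Mapping.single 0 (real (\<gamma> k) * fact M)) =
        Poly_Mapping.single (0 :: 'n \<Rightarrow>\<^sub>0 nat) (fact (Suc M))" .
  qed
  finally show ?case by simp
qed

definition frequency :: "nat \<Rightarrow> ('k::finite \<Rightarrow> nat) \<Rightarrow> real ^ 'k" where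
  "frequency M \<gamma> = (\<chi> k. real (\<gamma> k) / real M)"

definition bernstein_form ::
    "('k::finite \<Rightarrow> 'n rpoly) \<Rightarrow> nat \<Rightarrow> (('k \<Rightarrow> nat) \<Rightarrow> real) \<Rightarrow> 'n rpoly" where
  "bernstein_form y M c =
     (\<Sum>\<gamma>\<in>compositions M. Poly_Mapping.single 0 (fact M * c \<gamma>) * divided_monomial y \<gamma>)"

text \<open>
  Here \<open>F\<close> is meant to be \<open>p\<close> as a function of barycentric coordinates. Uniformity in \<open>\<gamma>\<close> is what
  turns positivity of \<open>F\<close> into positivity of all coefficients at once, and arbitrary \<open>\<epsilon>\<close> in place of a
  rate \<open>O(1/M)\<close> lets uniform continuity of \<open>F\<close> suffice in the product step.
\<close>

definition bernstein_approximable ::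
    "('k::finite \<Rightarrow> 'n rpoly) \<Rightarrow> 'n rpoly \<Rightarrow> (real ^ 'k \<Rightarrow> real) \<Rightarrow> bool" where
  "bernstein_approximable y p F \<longleftrightarrow>
     (\<forall>\<epsilon>>0. \<exists>M\<^sub>0. \<forall>M\<ge>M\<^sub>0. \<exists>c. p = bernstein_form y M c \<and>
        (\<forall>\<gamma>\<in>compositions M. \<bar>c \<gamma> - F (frequency M \<gamma>)\<bar> < \<epsilon>))"

lemma bernstein_approximableE:
  assumes "bernstein_approximable y p F" "\<epsilon> > 0"
  obtains M\<^sub>0 where "\<forall>M\<ge>M\<^sub>0. \<exists>c. p = bernstein_form y M c \<and>
    (\<forall>\<gamma>\<in>compositions M. \<bar>c \<gamma> - F (frequency M \<gamma>)\<bar> < \<epsilon>)"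
  using assms unfolding bernstein_approximable_def by blast

lemma frequency_in_cube: "\<gamma> \<in> compositions M \<Longrightarrow> frequency M \<gamma> \<in> cbox 0 1"
  using composition_le[of \<gamma> M]
  by (auto simp: frequency_def mem_box_cart divide_le_eq_1)

lemma sum_frequency:
  assumes "\<gamma> \<in> compositions M" "M > 0"
  shows "(\<Sum>k\<in>UNIV. frequency M \<gamma> $ k) = 1"
proof -
  have "(\<Sum>k\<in>UNIV. frequency M \<gamma> $ k) = real (sum \<gamma> UNIV) / real M"
    by (simp add: frequency_def sum_divide_distrib)
  with assms show ?thesis by (simp add: compositions_def)
qed

lemma dist_frequency_decrement:
  fixes \<gamma> :: "'k::finite \<Rightarrow> nat"
  assumes g: "\<gamma> \<in> compositions (Suc M)" and k: "\<gamma> k > 0" and M: "M > 0"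
  shows "dist (frequency M (\<gamma>(k := \<gamma> k - 1))) (frequency (Suc M) \<gamma>) \<le> real CARD('k) / real M"
proof -
  let ?\<delta> = "\<gamma>(k := \<gamma> k - 1)"
  have "\<bar>(frequency M ?\<delta> - frequency (Suc M) \<gamma>) $ j\<bar> \<le> 1 / real M" for j
  proof -
    have le: "real (\<gamma> j) \<le> real M + 1"
      using composition_le[OF g, of j] by simp
    have "real (?\<delta> j) = real (\<gamma> j) - (if j = k then 1 else 0)"
      using k by (auto simp: of_nat_diff Suc_le_eq)
    then have "(frequency M ?\<delta> - frequency (Suc M) \<gamma>) $ j =
        (real (\<gamma> j) - (if j = k then 1 else 0)) / real M - real (\<gamma> j) / (real M + 1)"
      by (simp add: frequency_def add.commute)
    also have "\<dots> = (if j = k then real (\<gamma> j) - (real M + 1) else real (\<gamma> j)) / (real M + 1) / real M"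
      using M by (simp add: field_simps)
    finally have eq: "(frequency M ?\<delta> - frequency (Suc M) \<gamma>) $ j = \<dots>" .
    have "\<bar>if j = k then real (\<gamma> j) - (real M + 1) else real (\<gamma> j)\<bar> / \<bar>real M + 1\<bar> \<le> 1"
      using le by (auto simp: divide_le_eq_1 abs_if)
    then have "\<bar>if j = k then real (\<gamma> j) - (real M + 1) else real (\<gamma> j)\<bar> / \<bar>real M + 1\<bar> / \<bar>real M\<bar>
        \<le> 1 / \<bar>real M\<bar>"
      by (rule divide_right_mono) simp
    then show ?thesis
      unfolding eq abs_divide by (simp only: abs_of_nat)
  qed
  then have "(\<Sum>j\<in>UNIV. \<bar>(frequency M ?\<delta> - frequency (Suc M) \<gamma>) $ j\<bar>) \<le> (\<Sum>j\<in>(UNIV::'k set). 1 / real M)"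
    by (rule sum_mono)
  then show ?thesis
    using norm_le_l1_cart[of "frequency M ?\<delta> - frequency (Suc M) \<gamma>"] by (simp add: dist_norm)
qed

lemma bernstein_approximable_1:
  assumes "sum y UNIV = 1"
  shows "bernstein_approximable y 1 (\<lambda>_. 1)"
  unfolding bernstein_approximable_def
proof (intro allI impI exI[of _ 0])
  fix \<epsilon> :: real and M :: nat assume "\<epsilon> > 0"
  then show "\<exists>c. 1 = bernstein_form y M c \<and>
      (\<forall>\<gamma>\<in>compositions M. \<bar>c \<gamma> - 1\<bar> < \<epsilon>)"
    by (intro exI[of _ "\<lambda>_. 1"]) (simp add: bernstein_form_def sum_divided_monomials[OF assms])
qed

lemma bernstein_approximable_add:
  assumes "bernstein_approximable y p F" "bernstein_approximable y q G"
  shows "bernstein_approximable y (p + q) (\<lambda>t. F t + G t)"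
  unfolding bernstein_approximable_def
proof (intro allI impI)
  fix \<epsilon> :: real assume "\<epsilon> > 0"
  then have "\<epsilon> / 2 > 0" by simp
  obtain M\<^sub>1 where
    M1: "\<forall>M\<ge>M\<^sub>1. \<exists>c. p = bernstein_form y M c \<and> (\<forall>\<gamma>\<in>compositions M. \<bar>c \<gamma> - F (frequency M \<gamma>)\<bar> < \<epsilon> / 2)"
    by (rule bernstein_approximableE[OF assms(1) \<open>\<epsilon> / 2 > 0\<close>])
  obtain M\<^sub>2 where
    M2: "\<forall>M\<ge>M\<^sub>2. \<exists>c. q = bernstein_form y M c \<and> (\<forall>\<gamma>\<in>compositions M. \<bar>c \<gamma> - G (frequency M \<gamma>)\<bar> < \<epsilon> / 2)"
    by (rule bernstein_approximableE[OF assms(2) \<open>\<epsilon> / 2 > 0\<close>])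
  show "\<exists>M\<^sub>0. \<forall>M\<ge>M\<^sub>0. \<exists>c. p + q = bernstein_form y M c \<and>
      (\<forall>\<gamma>\<in>compositions M. \<bar>c \<gamma> - (F (frequency M \<gamma>) + G (frequency M \<gamma>))\<bar> < \<epsilon>)"
  proof (intro exI[of _ "max M\<^sub>1 M\<^sub>2"] allI impI)
    fix M assume "M \<ge> max M\<^sub>1 M\<^sub>2"
    then have M: "M \<ge> M\<^sub>1" "M \<ge> M\<^sub>2" by simp_all
    obtain b where
      b: "p = bernstein_form y M b" "\<And>\<gamma>. \<gamma> \<in> compositions M \<Longrightarrow> \<bar>b \<gamma> - F (frequency M \<gamma>)\<bar> < \<epsilon> / 2"
      using M1 M(1) by blast
    obtain c where
      c: "q = bernstein_form y M c" "\<And>\<gamma>. \<gamma> \<in> compositions M \<Longrightarrow> \<bar>c \<gamma> - G (frequency M \<gamma>)\<bar> < \<epsilon> / 2"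
      using M2 M(2) by blast
    have "bernstein_form y M b + bernstein_form y M c = bernstein_form y M (\<lambda>\<gamma>. b \<gamma> + c \<gamma>)"
      by (simp add: bernstein_form_def distrib_left distrib_right single_add sum.distrib)
    then have "p + q = bernstein_form y M (\<lambda>\<gamma>. b \<gamma> + c \<gamma>)"
      using b(1) c(1) by simp
    moreover have "\<bar>b \<gamma> + c \<gamma> - (F (frequency M \<gamma>) + G (frequency M \<gamma>))\<bar> < \<epsilon>"
      if "\<gamma> \<in> compositions M" for \<gamma>
      using b(2)[OF that] c(2)[OF that] by linarith
    ultimately show "\<exists>c. p + q = bernstein_form y M c \<and>
        (\<forall>\<gamma>\<in>compositions M. \<bar>c \<gamma> - (F (frequency M \<gamma>) + G (frequency M \<gamma>))\<bar> < \<epsilon>)"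
      by (intro exI[of _ "\<lambda>\<gamma>. b \<gamma> + c \<gamma>"]) simp
  qed
qed

lemma bernstein_approximable_scale:
  assumes "bernstein_approximable y p F"
  shows "bernstein_approximable y (Poly_Mapping.single 0 a * p) (\<lambda>t. a * F t)"
  unfolding bernstein_approximable_def
proof (intro allI impI)
  fix \<epsilon> :: real assume "\<epsilon> > 0"
  then have pos: "\<epsilon> / (\<bar>a\<bar> + 1) > 0" by simp
  obtain M\<^sub>0 where
    M: "\<forall>M\<ge>M\<^sub>0. \<exists>c. p = bernstein_form y M c \<and>
      (\<forall>\<gamma>\<in>compositions M. \<bar>c \<gamma> - F (frequency M \<gamma>)\<bar> < \<epsilon> / (\<bar>a\<bar> + 1))"
    by (rule bernstein_approximableE[OF assms pos])
  show "\<exists>M\<^sub>0. \<forall>M\<ge>M\<^sub>0. \<exists>c. Poly_Mapping.single 0 a * p = bernstein_form y M c \<and>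
      (\<forall>\<gamma>\<in>compositions M. \<bar>c \<gamma> - a * F (frequency M \<gamma>)\<bar> < \<epsilon>)"
  proof (intro exI[of _ M\<^sub>0] allI impI)
    fix M assume "M \<ge> M\<^sub>0"
    then obtain c where
      c: "p = bernstein_form y M c" "\<And>\<gamma>. \<gamma> \<in> compositions M \<Longrightarrow> \<bar>c \<gamma> - F (frequency M \<gamma>)\<bar> < \<epsilon> / (\<bar>a\<bar> + 1)"
      using M by blast
    have "Poly_Mapping.single 0 a * bernstein_form y M c = bernstein_form y M (\<lambda>\<gamma>. a * c \<gamma>)"
      unfolding bernstein_form_def sum_distrib_left
      by (intro sum.cong refl)
        (simp add: mult.assoc[symmetric] mult_single, simp add: ac_simps)
    moreover have "\<bar>a * c \<gamma> - a * F (frequency M \<gamma>)\<bar> < \<epsilon>" if "\<gamma> \<in> compositions M" for \<gamma>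
    proof -
      have "\<bar>a * c \<gamma> - a * F (frequency M \<gamma>)\<bar> = \<bar>a\<bar> * \<bar>c \<gamma> - F (frequency M \<gamma>)\<bar>"
        by (simp add: abs_mult right_diff_distrib[symmetric])
      also have "\<dots> \<le> (\<bar>a\<bar> + 1) * \<bar>c \<gamma> - F (frequency M \<gamma>)\<bar>"
        by (intro mult_right_mono) auto
      also have "\<dots> < \<epsilon>"
        using c(2)[OF that] by (simp add: pos_less_divide_eq mult.commute add_pos_nonneg)
      finally show ?thesis .
    qed
    ultimately show "\<exists>c. Poly_Mapping.single 0 a * p = bernstein_form y M c \<and>
        (\<forall>\<gamma>\<in>compositions M. \<bar>c \<gamma> - a * F (frequency M \<gamma>)\<bar> < \<epsilon>)"
      using c(1) by (intro exI[of _ "\<lambda>\<gamma>. a * c \<gamma>"]) simp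
  qed
qed

text \<open>
  By the recurrence, if \<open>c\<close> are coefficients of \<open>p\<close> in degree \<open>M\<close>, then \<open>y\<^sub>k p\<close> has the coefficient
  \<open>\<gamma> k / (M + 1) \<cdot> c(\<gamma> - e\<^sub>k)\<close> in degree \<open>M + 1\<close>. The first factor is exactly the coordinate \<open>t\<^sub>k\<close> of the point of
  \<open>\<gamma>\<close>. The second is close to the value of \<open>F\<close> at the point of \<open>\<gamma> - e\<^sub>k\<close>, which tends to the point of \<open>\<gamma>\<close>
  uniformly, and \<open>F\<close> is uniformly continuous.
\<close>

lemma bernstein_approximable_mult:
  fixes y :: "'k::finite \<Rightarrow> 'n rpoly"
  assumes p: "bernstein_approximable y p F" and F: "continuous_on (cbox 0 1) F"
  shows "bernstein_approximable y (y k * p) (\<lambda>t. t $ k * F t)"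
  unfolding bernstein_approximable_def
proof (intro allI impI)
  fix \<epsilon> :: real assume "\<epsilon> > 0"
  then have \<epsilon>2: "\<epsilon> / 2 > 0" by simp
  have "uniformly_continuous_on (cbox 0 1) F"
    using F by (rule compact_uniformly_continuous) simp
  then obtain \<delta> where \<delta>: "\<delta> > 0"
    "\<And>t u. t \<in> cbox 0 1 \<Longrightarrow> u \<in> cbox 0 1 \<Longrightarrow> dist t u < \<delta> \<Longrightarrow> dist (F t) (F u) < \<epsilon> / 2"
    using \<epsilon>2 unfolding uniformly_continuous_on_def by metis
  obtain L :: nat where L: "real CARD('k) / \<delta> < real L"
    using reals_Archimedean2 by blast
  have L_less: "real CARD('k) / real M < \<delta>" if "M > L" for M
  proof -
    have "real CARD('k) < \<delta> * real L"
      using L \<open>\<delta> > 0\<close> by (simp add: pos_divide_less_eq mult.commute)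
    also have "\<dots> \<le> \<delta> * real M"
      using that \<open>\<delta> > 0\<close> by (intro mult_left_mono) auto
    finally show ?thesis using that by (simp add: pos_divide_less_eq)
  qed
  obtain M\<^sub>0 where
    M0: "\<forall>M\<ge>M\<^sub>0. \<exists>c. p = bernstein_form y M c \<and> (\<forall>\<gamma>\<in>compositions M. \<bar>c \<gamma> - F (frequency M \<gamma>)\<bar> < \<epsilon> / 2)"
    by (rule bernstein_approximableE[OF p \<epsilon>2])
  show "\<exists>M\<^sub>0. \<forall>M\<ge>M\<^sub>0. \<exists>c. y k * p = bernstein_form y M c \<and>
      (\<forall>\<gamma>\<in>compositions M. \<bar>c \<gamma> - frequency M \<gamma> $ k * F (frequency M \<gamma>)\<bar> < \<epsilon>)"
  proof (intro exI[of _ "Suc (max M\<^sub>0 (Suc L))"] allI impI)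
    fix M' assume "M' \<ge> Suc (max M\<^sub>0 (Suc L))"
    then obtain M where M': "M' = Suc M" and M: "M \<ge> M\<^sub>0" "M > L"
      by (cases M') auto
    obtain c where
      c: "p = bernstein_form y M c" "\<And>\<gamma>. \<gamma> \<in> compositions M \<Longrightarrow> \<bar>c \<gamma> - F (frequency M \<gamma>)\<bar> < \<epsilon> / 2"
      using M0 M(1) by blast
    let ?c = "\<lambda>\<gamma>. frequency (Suc M) \<gamma> $ k * c (\<gamma>(k := \<gamma> k - 1))"
    have coeff: "real (\<gamma> k) * (fact M * c (\<gamma>(k := \<gamma> k - 1))) = fact (Suc M) * ?c \<gamma>" for \<gamma>
      by (simp add: frequency_def del: of_nat_Suc)
    have "y k * p = bernstein_form y (Suc M) ?c"
      unfolding c(1) bernstein_form_def mult_sum_divided_monomials[where c = "\<lambda>\<gamma>. fact M * c \<gamma>"] coeff ..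
    moreover have "\<bar>?c \<gamma> - frequency (Suc M) \<gamma> $ k * F (frequency (Suc M) \<gamma>)\<bar> < \<epsilon>"
      if g: "\<gamma> \<in> compositions (Suc M)" for \<gamma>
    proof (cases "\<gamma> k = 0")
      case True
      then show ?thesis using \<open>\<epsilon> > 0\<close> by (simp add: frequency_def)
    next
      case False
      let ?\<delta> = "\<gamma>(k := \<gamma> k - 1)"
      have "Suc (sum ?\<delta> UNIV) = sum \<gamma> UNIV"
        using sum_fun_upd_Suc[of ?\<delta> k] False by simp
      then have d: "?\<delta> \<in> compositions M"
        using g by (simp add: compositions_def)
      have "real CARD('k) / real M < \<delta>"
        using L_less[of M] M(2) by simp
      then have "dist (frequency M ?\<delta>) (frequency (Suc M) \<gamma>) < \<delta>"
        using dist_frequency_decrement[OF g, of k] False M(2) by simp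
      then have "\<bar>F (frequency M ?\<delta>) - F (frequency (Suc M) \<gamma>)\<bar> < \<epsilon> / 2"
        using \<delta>(2)[OF frequency_in_cube[OF d] frequency_in_cube[OF g]] by (simp add: dist_real_def)
      with c(2)[OF d] have less: "\<bar>c ?\<delta> - F (frequency (Suc M) \<gamma>)\<bar> < \<epsilon>" by linarith
      have t: "0 \<le> frequency (Suc M) \<gamma> $ k" "frequency (Suc M) \<gamma> $ k \<le> 1"
        using frequency_in_cube[OF g] by (auto simp: mem_box_cart)
      have "\<bar>?c \<gamma> - frequency (Suc M) \<gamma> $ k * F (frequency (Suc M) \<gamma>)\<bar> =
          frequency (Suc M) \<gamma> $ k * \<bar>c ?\<delta> - F (frequency (Suc M) \<gamma>)\<bar>"
        using t by (simp add: abs_mult right_diff_distrib[symmetric])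
      also have "\<dots> \<le> 1 * \<bar>c ?\<delta> - F (frequency (Suc M) \<gamma>)\<bar>"
        using t by (intro mult_right_mono) auto
      finally show ?thesis using less by simp
    qed
    ultimately show "\<exists>c. y k * p = bernstein_form y M' c \<and>
        (\<forall>\<gamma>\<in>compositions M'. \<bar>c \<gamma> - frequency M' \<gamma> $ k * F (frequency M' \<gamma>)\<bar> < \<epsilon>)"
      unfolding M' by (intro exI[of _ ?c]) simp
  qed
qed


definition standard_simplex :: "(real ^ 'k::finite) set" where
  "standard_simplex = {t. (\<forall>k. t $ k \<ge> 0) \<and> (\<Sum>k\<in>UNIV. t $ k) = 1}"

lemma standard_simplex_subset_cube: "standard_simplex \<subseteq> cbox 0 1"
proof
  fix t :: "real ^ 'a" assume "t \<in> standard_simplex"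
  then have t: "\<And>k. t $ k \<ge> 0" "(\<Sum>k\<in>UNIV. t $ k) = 1"
    by (auto simp: standard_simplex_def)
  then have "t $ k \<le> 1" for k
    using member_le_sum[of k UNIV "\<lambda>k. t $ k"] by simp
  with t show "t \<in> cbox 0 1" by (simp add: mem_box_cart)
qed

lemma compact_standard_simplex: "compact standard_simplex"
proof -
  have "closed {t::real ^ 'a. (\<forall>k. t $ k \<ge> 0) \<and> (\<Sum>k\<in>UNIV. t $ k) = 1}"
    by (intro closed_Collect_conj closed_Collect_all closed_Collect_le closed_Collect_eq continuous_intros)
  then show ?thesis
    using standard_simplex_subset_cube bounded_subset[OF bounded_cbox]
    by (auto simp: compact_eq_bounded_closed standard_simplex_def)
qed

lemma frequency_in_standard_simplex:
  assumes "\<gamma> \<in> compositions M" "M > 0"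
  shows "frequency M \<gamma> \<in> standard_simplex"
  using sum_frequency[OF assms] by (simp add: standard_simplex_def frequency_def)

section \<open>Semirings containing the positive polynomials\<close>

definition nonneg_semiring :: "'n rpoly set \<Rightarrow> bool" where
  "nonneg_semiring S \<longleftrightarrow>
     (\<forall>c\<ge>0. Poly_Mapping.single 0 c \<in> S) \<and> (\<forall>p\<in>S. \<forall>q\<in>S. p + q \<in> S \<and> p * q \<in> S)"

lemma nonneg_semiringD:
  assumes "nonneg_semiring S"
  shows "c \<ge> 0 \<Longrightarrow> Poly_Mapping.single 0 c \<in> S"
    and "p \<in> S \<Longrightarrow> q \<in> S \<Longrightarrow> p + q \<in> S"
    and "p \<in> S \<Longrightarrow> q \<in> S \<Longrightarrow> p * q \<in> S"
  using assms by (auto simp: nonneg_semiring_def)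

lemma nonneg_semiring_1: "nonneg_semiring S \<Longrightarrow> 1 \<in> S"
  using nonneg_semiringD(1)[of S 1] by simp

lemma nonneg_semiring_sum:
  assumes "nonneg_semiring S" "\<And>i. i \<in> I \<Longrightarrow> p i \<in> S"
  shows "(\<Sum>i\<in>I. p i) \<in> S"
  using assms(2) nonneg_semiringD(1)[OF assms(1), of 0]
  by (induction I rule: infinite_finite_induct) (auto intro: nonneg_semiringD(2)[OF assms(1)])

lemma nonneg_semiring_power:
  "nonneg_semiring S \<Longrightarrow> p \<in> S \<Longrightarrow> p ^ m \<in> S"
  by (induction m) (auto intro: nonneg_semiringD nonneg_semiring_1)

lemma nonneg_semiring_prod:
  assumes "nonneg_semiring S" "\<And>i. i \<in> I \<Longrightarrow> p i \<in> S"
  shows "(\<Prod>i\<in>I. p i) \<in> S"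
  using assms(2) nonneg_semiring_1[OF assms(1)]
  by (induction I rule: infinite_finite_induct) (auto intro: nonneg_semiringD(3)[OF assms(1)])

text \<open>
  By compactness \<open>F\<close> has a positive minimum on the simplex. Once the coefficients approximate \<open>F\<close> to within
  this minimum they are nonnegative, and the expansion displays \<open>p\<close> as an element of the semiring.
\<close>

lemma positive_imp_in_semiring:
  fixes y :: "'k::finite \<Rightarrow> 'n rpoly"
  assumes S: "nonneg_semiring S" "\<And>k. y k \<in> S"
    and p: "bernstein_approximable y p F"
    and F: "continuous_on standard_simplex F" "\<And>t. t \<in> standard_simplex \<Longrightarrow> F t > 0"
  shows "p \<in> S"
proof -
  have "frequency 1 (\<lambda>k. if k = undefined then 1 else 0) \<in> (standard_simplex :: (real ^ 'k) set)"
    by (rule frequency_in_standard_simplex) (simp_all add: compositions_def)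
  then obtain t\<^sub>0 where t0: "t\<^sub>0 \<in> standard_simplex" "\<And>t. t \<in> standard_simplex \<Longrightarrow> F t\<^sub>0 \<le> F t"
    using continuous_attains_inf[OF compact_standard_simplex _ F(1)] by blast
  obtain M\<^sub>0 where M0: "\<forall>M\<ge>M\<^sub>0. \<exists>c. p = bernstein_form y M c \<and>
      (\<forall>\<gamma>\<in>compositions M. \<bar>c \<gamma> - F (frequency M \<gamma>)\<bar> < F t\<^sub>0)"
    by (rule bernstein_approximableE[OF p F(2)[OF t0(1)]])
  define M where "M = Suc M\<^sub>0"
  then have "M \<ge> M\<^sub>0" by simp
  then obtain c where
    c: "p = bernstein_form y M c"
      "\<And>\<gamma>. \<gamma> \<in> compositions M \<Longrightarrow> \<bar>c \<gamma> - F (frequency M \<gamma>)\<bar> < F t\<^sub>0"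
    using M0 by blast
  have "c \<gamma> \<ge> 0" if "\<gamma> \<in> compositions M" for \<gamma>
    using c(2)[OF that] t0(2)[OF frequency_in_standard_simplex[OF that]] by (simp add: M_def)
  moreover have "divided_monomial y \<gamma> \<in> S" for \<gamma>
    unfolding divided_monomial_def
    by (intro nonneg_semiringD(3)[OF S(1)] nonneg_semiringD(1)[OF S(1)]
        nonneg_semiring_prod[OF S(1)] nonneg_semiring_power[OF S(1)] S(2))
      (simp add: prod_nonneg)
  ultimately show "p \<in> S"
    unfolding c(1) bernstein_form_def
    by (intro nonneg_semiring_sum[OF S(1)] nonneg_semiringD(3)[OF S(1)] nonneg_semiringD(1)[OF S(1)]) auto
qed

section \<open>Positivity on a simplex\<close>

abbreviation var :: "'n \<Rightarrow> 'n rpoly" where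
  "var i \<equiv> Poly_Mapping.single (Poly_Mapping.single i 1) 1"

definition scaled_simplex :: "('n::finite \<Rightarrow> real) \<Rightarrow> (real ^ 'n) set" where
  "scaled_simplex a = {x. (\<forall>i. x $ i \<ge> 0) \<and> (\<Sum>i\<in>UNIV. a i * x $ i) \<le> 1}"

text \<open>
  Multiplication by a variable is the only product that is needed to build polynomials, which matches
  the product step for Bernstein approximation.
\<close>

lemma rpoly_induct [case_names const add var]:
  fixes p :: "'n rpoly"
  assumes const: "\<And>c. P (Poly_Mapping.single 0 c)"
    and add: "\<And>p q. P p \<Longrightarrow> P q \<Longrightarrow> P (p + q)"
    and var: "\<And>i p. P p \<Longrightarrow> P (var i * p)"
  shows "P p"
proof -
  have monomial: "P (Poly_Mapping.single \<alpha> 1 * q)" if "P q" for \<alpha> q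
    using that
  proof (induction \<alpha> arbitrary: q rule: poly_mapping_single_add_induct)
    case (single i m)
    show ?case
    proof (induction m)
      case 0
      show ?case using single by simp
    next
      case (Suc m)
      have "Poly_Mapping.single (Poly_Mapping.single i (Suc m)) 1 * q =
          var i * (Poly_Mapping.single (Poly_Mapping.single i m) 1 * q)"
        by (simp add: mult.assoc[symmetric] mult_single single_add[symmetric])
      then show ?case using var[OF Suc] by simp
    qed
  next
    case (add \<alpha> \<beta>)
    have "Poly_Mapping.single (\<alpha> + \<beta>) 1 * q =
        Poly_Mapping.single \<alpha> 1 * (Poly_Mapping.single \<beta> 1 * q)"
      by (simp add: mult.assoc[symmetric] mult_single)
    then show ?case using add by simp
  qed
  show ?thesis
  proof (induction p rule: poly_mapping_single_add_induct)
    case (single \<alpha> c)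
    show ?case using monomial[OF const, of \<alpha> c] by (simp add: mult_single)
  qed (rule add)
qed

text \<open>
  The barycentric coordinates of a point of the simplex are \<open>a\<^sub>i x\<^sub>i\<close> together with the slack
  \<open>1 - \<Sum>a\<^sub>i x\<^sub>i\<close>; they are indexed by \<open>Some i\<close> and \<open>None\<close>. As polynomials they add up to \<open>1\<close>, so
  every polynomial is Bernstein approximable with respect to them, by induction.
\<close>

lemma positive_on_simplex_imp_in_semiring:
  fixes p :: "'n::finite rpoly" and a :: "'n \<Rightarrow> real"
  assumes a: "\<And>i. a i > 0"
    and S: "nonneg_semiring S" "\<And>i. var i \<in> S"
      "1 - (\<Sum>i\<in>UNIV. Poly_Mapping.single (Poly_Mapping.single i 1) (a i)) \<in> S"
    and pos: "\<And>x. x \<in> scaled_simplex a \<Longrightarrow> poly_eval p x > 0"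
  shows "p \<in> S"
proof -
  let ?m = "\<lambda>i. Poly_Mapping.single (Poly_Mapping.single i 1) (a i) :: 'n rpoly"
  define y where "y = case_option (1 - (\<Sum>i\<in>UNIV. ?m i)) ?m"
  have y_simps: "y None = 1 - (\<Sum>i\<in>UNIV. ?m i)" "y (Some i) = ?m i" for i
    by (simp_all add: y_def)
  let ?x = "\<lambda>t :: real ^ 'n option. \<chi> i. t $ Some i / a i"
  have sum_option: "(\<Sum>k\<in>UNIV. g k) = g None + (\<Sum>i\<in>UNIV. g (Some i))"
    for g :: "'n option \<Rightarrow> 'b::comm_monoid_add"
    by (simp add: UNIV_option_conv sum.reindex)
  have one: "sum y UNIV = 1"
    by (simp add: sum_option y_simps)
  have m: "?m i = Poly_Mapping.single 0 (a i) * var i" for i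
    by (simp add: mult_single)
  have m_in: "?m i \<in> S" for i
    unfolding m using a[of i]
    by (intro nonneg_semiringD(3)[OF S(1)] nonneg_semiringD(1)[OF S(1)] S(2)) simp
  have y: "y k \<in> S" for k
    using S(3) m_in by (cases k) (simp_all only: y_simps)
  have cont: "continuous_on A (\<lambda>t. poly_eval q (?x t))" for A and q :: "'n rpoly"
    by (rule continuous_on_compose2[OF continuous_on_poly_eval[of UNIV]])
      (use a in \<open>auto intro!: continuous_intros simp: less_imp_neq[symmetric]\<close>)
  have "bernstein_approximable y q (\<lambda>t. poly_eval q (?x t))" for q
  proof (induction q rule: rpoly_induct)
    case (const c)
    show ?case
      using bernstein_approximable_scale[OF bernstein_approximable_1[OF one], of c] by simp
  next
    case (add p q)
    then show ?case by (simp add: poly_eval_add bernstein_approximable_add)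
  next
    case (var i q)
    have "bernstein_approximable y (Poly_Mapping.single 0 (1 / a i) * (y (Some i) * q))
        (\<lambda>t. 1 / a i * (t $ Some i * poly_eval q (?x t)))"
      using bernstein_approximable_scale[OF
          bernstein_approximable_mult[OF var cont, where k = "Some i"], of "1 / a i"] by simp
    moreover have "Poly_Mapping.single 0 (1 / a i) * (y (Some i) * q) = var i * q"
      using a[of i] by (simp add: y_simps mult.assoc[symmetric] mult_single)
    moreover have "poly_eval (var i * q) (?x t) = 1 / a i * (t $ Some i * poly_eval q (?x t))" for t
      by (simp add: poly_eval_mult del: One_nat_def)
    ultimately show ?case by simp
  qed
  then have "bernstein_approximable y p (\<lambda>t. poly_eval p (?x t))" .
  moreover have "poly_eval p (?x t) > 0" if "t \<in> standard_simplex" for t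
  proof (rule pos)
    have t: "\<And>k. t $ k \<ge> 0" "t $ None + (\<Sum>i\<in>UNIV. t $ Some i) = 1"
      using that by (auto simp: standard_simplex_def sum_option)
    have "(\<Sum>i\<in>UNIV. a i * ?x t $ i) = (\<Sum>i\<in>UNIV. t $ Some i)"
      using a by (intro sum.cong) (auto simp: less_imp_neq[symmetric])
    then have "(\<Sum>i\<in>UNIV. a i * ?x t $ i) \<le> 1" using t(1)[of None] t(2) by linarith
    then show "?x t \<in> scaled_simplex a"
      using t(1) a by (simp add: scaled_simplex_def less_imp_le)
  qed
  ultimately show ?thesis
    by (intro positive_imp_in_semiring[where y = y, OF S(1) y _ cont])
qed


section \<open>Positivity modulo \<open>r - 1\<close>\<close>

lemma poly_cong_refl: "poly_cong f f h"
  by (simp add: poly_cong_def)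

lemma poly_cong_add: "poly_cong f f' h \<Longrightarrow> poly_cong g g' h \<Longrightarrow> poly_cong (f + g) (f' + g') h"
  unfolding poly_cong_def using dvd_add[of h "f - f'" "g - g'"] by (simp add: algebra_simps)

lemma poly_cong_sum:
  "(\<And>i. i \<in> I \<Longrightarrow> poly_cong (p i) (q i) h) \<Longrightarrow> poly_cong (\<Sum>i\<in>I. p i) (\<Sum>i\<in>I. q i) h"
  by (induction I rule: infinite_finite_induct) (auto simp: poly_cong_refl poly_cong_add)

lemma poly_cong_trans: "poly_cong f g h \<Longrightarrow> poly_cong g k h \<Longrightarrow> poly_cong f k h"
  unfolding poly_cong_def using dvd_add[of h "f - g" "g - k"] by simp

lemma poly_cong_mult:
  assumes "poly_cong f f' h" "poly_cong g g' h"
  shows "poly_cong (f * g) (f' * g') h"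
proof -
  have "f * g - f' * g' = (f - f') * g + f' * (g - g')" by (simp add: algebra_simps)
  with assms show ?thesis unfolding poly_cong_def by (simp add: dvd_add)
qed

lemma poly_cong_eval:
  assumes "poly_cong f g h" "poly_eval h x = 0"
  shows "poly_eval f x = poly_eval g x"
proof -
  from assms(1) obtain k where "f - g = h * k" by (auto simp: poly_cong_def dvd_def)
  then have "poly_eval f x - poly_eval g x = poly_eval h x * poly_eval k x"
    by (metis poly_eval_diff poly_eval_mult)
  with assms(2) show ?thesis by simp
qed

text \<open>
  This is the semiring to which positivity on the simplex is applied.
\<close>

lemma nonneg_semiring_cong: "nonneg_semiring {p. \<exists>q\<in>nonneg_rpoly. poly_cong p q h}"
  unfolding nonneg_semiring_def
  by (auto intro: poly_cong_refl nonneg_rpoly_single poly_cong_add poly_cong_mult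
      nonneg_rpoly_add nonneg_rpoly_mult)

lemma poly_cong_power_1: "poly_cong 1 (r ^ d) (r - 1)"
proof (induction d)
  case (Suc d)
  have "poly_cong 1 r (r - 1)"
    unfolding poly_cong_def by (metis dvd_minus_iff dvd_refl minus_diff_eq)
  from poly_cong_mult[OF this Suc] show ?case by simp
qed (simp add: poly_cong_refl)

text \<open>
  The set where \<open>f \<le> 0\<close> is compact and disjoint from the zeros of \<open>g\<close>, so \<open>g\<close> has a positive minimum
  there, and a multiple of \<open>g\<close> outweighs the minimum of \<open>f\<close>.
\<close>

lemma exists_penalty:
  fixes f g :: "'a::topological_space \<Rightarrow> real"
  assumes K: "compact K" and cont: "continuous_on K f" "continuous_on K g"
    and g: "\<And>x. x \<in> K \<Longrightarrow> g x \<ge> 0"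
    and pos: "\<And>x. x \<in> K \<Longrightarrow> g x = 0 \<Longrightarrow> f x > 0"
  shows "\<exists>C. \<exists>\<epsilon>>0. \<forall>x\<in>K. f x + C * g x > \<epsilon>"
proof (cases "K = {}")
  case False
  obtain x\<^sub>0 where x0: "\<And>x. x \<in> K \<Longrightarrow> f x\<^sub>0 \<le> f x"
    using continuous_attains_inf[OF K False cont(1)] by blast
  have "\<exists>C\<ge>0. \<forall>x\<in>K. f x \<le> 0 \<longrightarrow> C * g x > - f x"
  proof (cases "\<exists>x\<in>K. f x \<le> 0")
    case True
    have "{x \<in> K. f x \<le> 0} = K \<inter> f -` {..0}" by auto
    then have "closedin (top_of_set K) {x \<in> K. f x \<le> 0}"
      using continuous_closedin_preimage[OF cont(1) closed_atMost[of 0]] by simp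
    then have "compact {x \<in> K. f x \<le> 0}"
      using closedin_compact[OF K] by blast
    then obtain x\<^sub>1 where x1: "x\<^sub>1 \<in> K" "f x\<^sub>1 \<le> 0" "\<And>x. x \<in> K \<Longrightarrow> f x \<le> 0 \<Longrightarrow> g x\<^sub>1 \<le> g x"
      using continuous_attains_inf[of "{x \<in> K. f x \<le> 0}" g] True
        continuous_on_subset[OF cont(2), of "{x \<in> K. f x \<le> 0}"] by auto
    have m: "g x\<^sub>1 > 0" using pos[of x\<^sub>1] g[of x\<^sub>1] x1(1,2) by force
    have "f x\<^sub>0 \<le> 0" using x0[OF x1(1)] x1(2) by linarith
    (* Then C * g >= 1 - min f on the set where f <= 0, so f + C * g >= 1 there. *)
    let ?C = "(1 - f x\<^sub>0) / g x\<^sub>1"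
    have C: "?C \<ge> 0" using m \<open>f x\<^sub>0 \<le> 0\<close> by simp
    moreover have "?C * g x > - f x" if "x \<in> K" "f x \<le> 0" for x
    proof -
      have "?C * g x \<ge> ?C * g x\<^sub>1" using C x1(3)[OF that] by (intro mult_left_mono)
      moreover have "?C * g x\<^sub>1 = 1 - f x\<^sub>0" using m by simp
      ultimately show ?thesis using x0[OF that(1)] by linarith
    qed
    ultimately show ?thesis by blast
  qed auto
  then obtain C where C: "C \<ge> 0" "\<And>x. x \<in> K \<Longrightarrow> f x \<le> 0 \<Longrightarrow> C * g x > - f x" by blast
  have pos': "f x + C * g x > 0" if "x \<in> K" for x
  proof (cases "f x \<le> 0")
    case False
    have "C * g x \<ge> 0" using C(1) g[OF that] by simp
    with False show ?thesis by linarith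
  qed (use C(2)[OF that] in auto)
  have "continuous_on K (\<lambda>x. f x + C * g x)" by (intro continuous_intros cont)
  then obtain x\<^sub>2 where x2: "x\<^sub>2 \<in> K" "\<And>x. x \<in> K \<Longrightarrow> f x\<^sub>2 + C * g x\<^sub>2 \<le> f x + C * g x"
    using continuous_attains_inf[OF K False, of "\<lambda>x. f x + C * g x"] by blast
  have "f x + C * g x > (f x\<^sub>2 + C * g x\<^sub>2) / 2" if "x \<in> K" for x
    using x2(2)[OF that] pos'[OF x2(1)] by simp
  then show ?thesis
    using pos'[OF x2(1)] by (intro exI[of _ C] exI[of _ "(f x\<^sub>2 + C * g x\<^sub>2) / 2"]) simp
qed (auto intro: exI[of _ 1])

lemma compact_scaled_simplex:
  assumes a: "\<And>i. a i > 0"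
  shows "compact (scaled_simplex a)"
proof -
  have "scaled_simplex a \<subseteq> cbox 0 (\<chi> i. 1 / a i)"
  proof
    fix x assume "x \<in> scaled_simplex a"
    then have x: "\<And>i. x $ i \<ge> 0" "(\<Sum>i\<in>UNIV. a i * x $ i) \<le> 1"
      by (auto simp: scaled_simplex_def)
    have "a i * x $ i \<le> 1" for i
      using member_le_sum[of i UNIV "\<lambda>i. a i * x $ i"] x a by (simp add: less_imp_le)
    then show "x \<in> cbox 0 (\<chi> i. 1 / a i)"
      using x(1) a by (simp add: mem_box_cart pos_le_divide_eq mult.commute)
  qed
  moreover have "closed {x::real ^ 'a. (\<forall>i. x $ i \<ge> 0) \<and> (\<Sum>i\<in>UNIV. a i * x $ i) \<le> 1}"
    by (intro closed_Collect_conj closed_Collect_all closed_Collect_le continuous_intros)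
  ultimately show ?thesis
    using bounded_subset[OF bounded_cbox]
    by (auto simp: compact_eq_bounded_closed scaled_simplex_def)
qed

text \<open>
  Replacing \<open>1\<close> by \<open>r\<close> in the slack gives \<open>r\<close> with its linear terms deleted.
\<close>

lemma slack_cong_nonneg:
  fixes r :: "'n::finite rpoly"
  assumes "r \<in> nonneg_rpoly"
  shows "\<exists>q\<in>nonneg_rpoly. poly_cong
    (1 - (\<Sum>i\<in>UNIV. Poly_Mapping.single (Poly_Mapping.single i 1)
                        (Poly_Mapping.lookup r (Poly_Mapping.single i 1)))) q (r - 1)"
proof -
  let ?e = "\<lambda>i :: 'n. Poly_Mapping.single i (1::nat)"
  let ?l = "\<Sum>i\<in>UNIV. Poly_Mapping.single (?e i) (Poly_Mapping.lookup r (?e i))"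
  have inj: "inj ?e"
    by (intro injI) (metis lookup_single_eq lookup_single_not_eq zero_neq_one)
  have "Poly_Mapping.lookup ?l \<alpha> = (if \<alpha> \<in> range ?e then Poly_Mapping.lookup r \<alpha> else 0)" for \<alpha>
  proof -
    have "Poly_Mapping.lookup ?l \<alpha> = (\<Sum>\<beta>\<in>range ?e. if \<beta> = \<alpha> then Poly_Mapping.lookup r \<beta> else 0)"
      unfolding sum.reindex[OF inj] lookup_sum lookup_single when_def comp_def ..
    then show ?thesis by simp
  qed
  then have "r - ?l \<in> nonneg_rpoly"
    using assms by (simp add: nonneg_rpoly_def lookup_minus)
  moreover have "poly_cong (1 - ?l) (r - ?l) (r - 1)"
    unfolding poly_cong_def using dvd_minus_iff[of "r - 1" "r - 1"] by simp
  ultimately show ?thesis by blast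
qed

text \<open>
  The positive constant split off here is what is later spread over all required exponents.
\<close>

lemma positive_imp_cong_nonneg_plus_const:
  fixes r f :: "'n::finite rpoly"
  assumes r: "r \<in> nonneg_rpoly" and units: "unit_exponents \<subseteq> Log r"
    and pos: "\<And>x. x \<in> nonneg_level_one r \<Longrightarrow> poly_eval f x > 0"
  shows "\<exists>\<epsilon>>0. \<exists>q\<in>nonneg_rpoly. poly_cong f (q + Poly_Mapping.single 0 \<epsilon>) (r - 1)"
proof -
  define a where "a i = Poly_Mapping.lookup r (Poly_Mapping.single i 1)" for i
  have a: "a i > 0" for i
    using units by (auto simp: a_def Log_def unit_exponents_def)
  let ?S = "{p. \<exists>q\<in>nonneg_rpoly. poly_cong p q (r - 1)}"
  let ?h = "(r - 1) * (r - 1)"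
  have "\<exists>C. \<exists>\<epsilon>>0. \<forall>x\<in>scaled_simplex a. poly_eval f x + C * poly_eval ?h x > \<epsilon>"
  proof (rule exists_penalty)
    fix x assume x: "x \<in> scaled_simplex a"
    show "poly_eval ?h x \<ge> 0" by (simp add: poly_eval_mult)
    assume "poly_eval ?h x = 0"
    then show "poly_eval f x > 0"
      using x by (intro pos) (simp add: poly_eval_mult poly_eval_diff nonneg_level_one_def scaled_simplex_def)
  qed (auto intro: compact_scaled_simplex a continuous_on_poly_eval)
  then obtain C \<epsilon> where \<epsilon>: "\<epsilon> > 0"
    and C: "\<And>x. x \<in> scaled_simplex a \<Longrightarrow> poly_eval f x + C * poly_eval ?h x > \<epsilon>"
    by blast
  let ?p = "f + Poly_Mapping.single 0 C * ?h - Poly_Mapping.single 0 \<epsilon>"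
  have "?p \<in> ?S"
  proof (rule positive_on_simplex_imp_in_semiring[OF a nonneg_semiring_cong])
    show "var i \<in> ?S" for i
      by (rule CollectI, rule bexI, rule poly_cong_refl, rule nonneg_rpoly_single, simp)
    show "1 - (\<Sum>i\<in>UNIV. Poly_Mapping.single (Poly_Mapping.single i 1) (a i)) \<in> ?S"
      using slack_cong_nonneg[OF r] by (simp add: a_def)
    show "poly_eval ?p x > 0" if "x \<in> scaled_simplex a" for x
      using C[OF that] by (simp add: poly_eval_diff poly_eval_add poly_eval_mult)
  qed
  then obtain q where q: "q \<in> nonneg_rpoly" "poly_cong ?p q (r - 1)" by blast
  have "f - (?p + Poly_Mapping.single 0 \<epsilon>) = (r - 1) * (- Poly_Mapping.single 0 C * (r - 1))"
    by (simp add: algebra_simps)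
  then have "r - 1 dvd f - (?p + Poly_Mapping.single 0 \<epsilon>)" by (rule dvdI)
  then have "poly_cong f (?p + Poly_Mapping.single 0 \<epsilon>) (r - 1)"
    unfolding poly_cong_def .
  moreover have "poly_cong (?p + Poly_Mapping.single 0 \<epsilon>) (q + Poly_Mapping.single 0 \<epsilon>) (r - 1)"
    by (rule poly_cong_add[OF q(2) poly_cong_refl])
  ultimately have "poly_cong f (q + Poly_Mapping.single 0 \<epsilon>) (r - 1)"
    by (rule poly_cong_trans)
  with q(1) \<epsilon> show ?thesis by blast
qed

text \<open>
  Each power of \<open>r\<close> is congruent to \<open>1\<close>, so \<open>\<epsilon>\<close> can be distributed evenly over \<open>r\<^sup>0, \<dots>, r\<^sup>N\<close>.
\<close>

lemma const_cong_full_support: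
  fixes r :: "'n rpoly"
  assumes r: "r \<in> nonneg_rpoly" and \<epsilon>: "\<epsilon> > 0"
  shows "\<exists>q\<in>nonneg_rpoly. Log q = (\<Union>d\<in>{0..N}. minkowski_multiple d (Log r)) \<and>
    poly_cong (Poly_Mapping.single 0 \<epsilon>) q (r - 1)"
proof -
  define \<eta> where "\<eta> = \<epsilon> / (real N + 1)"
  have \<eta>: "\<eta> > 0" using \<epsilon> by (simp add: \<eta>_def)
  let ?q = "\<Sum>d\<in>{0..N}. Poly_Mapping.single 0 \<eta> * r ^ d"
  have terms: "Poly_Mapping.single 0 \<eta> * r ^ d \<in> nonneg_rpoly" for d
    using r \<eta> by (intro nonneg_rpoly_mult nonneg_rpoly_single nonneg_rpoly_power) simp_all
  have "Log (Poly_Mapping.single 0 \<eta> * r ^ d) = minkowski_multiple d (Log r)" for d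
    using r \<eta> by (simp add: Log_mult Log_power Log_single nonneg_rpoly_single nonneg_rpoly_power
        set_plus_def)
  then have "Log ?q = (\<Union>d\<in>{0..N}. minkowski_multiple d (Log r))"
    using terms by (simp add: Log_sum)
  moreover have "poly_cong (\<Sum>d\<in>{0..N}. Poly_Mapping.single 0 \<eta> * 1) ?q (r - 1)"
    by (intro poly_cong_sum poly_cong_mult poly_cong_refl poly_cong_power_1)
  moreover have "(\<Sum>d\<in>{0..N}. Poly_Mapping.single 0 \<eta> * 1) = (Poly_Mapping.single 0 \<epsilon> :: 'n rpoly)"
    unfolding mult_1_right single_sum[symmetric] by (simp add: \<eta>_def add.commute)
  moreover have "?q \<in> nonneg_rpoly" by (intro nonneg_rpoly_sum terms)
  ultimately show ?thesis by (intro bexI[of _ ?q] conjI) (simp_all only:)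
qed

lemma positive_on_level_set:
  fixes r f q :: "'n::finite rpoly"
  assumes q: "q \<in> nonneg_rpoly" "0 \<in> Log q" and cong: "poly_cong f q (r - 1)"
    and x: "x \<in> nonneg_level_one r"
  shows "poly_eval f x > 0"
proof -
  have nonneg: "monom_eval \<alpha> x \<ge> 0" for \<alpha>
    using x by (simp add: nonneg_level_one_def monom_eval_def prod_nonneg)
  have "0 < Poly_Mapping.lookup q 0 * monom_eval 0 x"
    using q(2) by (simp add: Log_def)
  also have "\<dots> \<le> poly_eval q x"
    unfolding poly_eval_def
    by (rule member_le_sum[where f = "\<lambda>\<alpha>. Poly_Mapping.lookup q \<alpha> * monom_eval \<alpha> x"])
      (use q nonneg in \<open>auto simp: Log_def in_keys_iff nonneg_rpoly_def\<close>)
  also have "poly_eval q x = poly_eval f x"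
    using poly_cong_eval[OF cong] x by (simp add: poly_eval_diff nonneg_level_one_def)
  finally show ?thesis .
qed

theorem theorem2:
  fixes r f :: "'n::finite rpoly"
  assumes "r \<in> nonneg_rpoly"
    and "unit_exponents \<subseteq> Log r"
  shows "((\<forall>x\<in>nonneg_level_one r. poly_eval f x > 0) \<longleftrightarrow>
          (\<exists>N\<^sub>0::nat. \<forall>N\<ge>N\<^sub>0. \<exists>q\<in>nonneg_rpoly.
            Log q = (\<Union>d\<in>{0..N}. minkowski_multiple d (Log r)) \<and> poly_cong f q (r - 1))) \<and>
         ((\<exists>N\<^sub>0::nat. \<forall>N\<ge>N\<^sub>0. \<exists>q\<in>nonneg_rpoly.
            Log q = (\<Union>d\<in>{0..N}. minkowski_multiple d (Log r)) \<and> poly_cong f q (r - 1)) \<longleftrightarrow>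
          (\<exists>N::nat. \<exists>q\<in>nonneg_rpoly.
            Log q = (\<Union>d\<in>{0..N}. minkowski_multiple d (Log r)) \<and> poly_cong f q (r - 1)))"
    (is "(?a \<longleftrightarrow> ?b) \<and> (?b \<longleftrightarrow> ?c)")
proof -
  let ?L = "\<lambda>N. \<Union>d\<in>{0..N}. minkowski_multiple d (Log r)"
  have ab: ?b if ?a
  proof -
    have "\<exists>\<epsilon>>0. \<exists>q\<in>nonneg_rpoly. poly_cong f (q + Poly_Mapping.single 0 \<epsilon>) (r - 1)"
      by (rule positive_imp_cong_nonneg_plus_const[OF assms bspec[OF that]])
    then obtain \<epsilon> q\<^sub>0 where \<epsilon>: "\<epsilon> > 0" and q0: "q\<^sub>0 \<in> nonneg_rpoly"
      "poly_cong f (q\<^sub>0 + Poly_Mapping.single 0 \<epsilon>) (r - 1)"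
      by (elim exE conjE bexE)
    obtain N\<^sub>0 where N0: "\<And>N. N \<ge> N\<^sub>0 \<Longrightarrow> Poly_Mapping.keys q\<^sub>0 \<subseteq> ?L N"
      using finite_exponents_in_minkowski_multiples[OF finite_keys assms(2)] by blast
    have "\<exists>q\<in>nonneg_rpoly. Log q = ?L N \<and> poly_cong f q (r - 1)" if "N \<ge> N\<^sub>0" for N
    proof -
      obtain q where q: "q \<in> nonneg_rpoly" "Log q = ?L N"
        "poly_cong (Poly_Mapping.single 0 \<epsilon>) q (r - 1)"
        using const_cong_full_support[OF assms(1) \<epsilon>] by blast
      have "Log (q\<^sub>0 + q) = ?L N"
        using N0[OF that] by (auto simp: Log_add[OF q0(1) q(1)] q(2) Log_eq_keys[OF q0(1)])
      moreover have "poly_cong f (q\<^sub>0 + q) (r - 1)"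
        using poly_cong_trans[OF q0(2) poly_cong_add[OF poly_cong_refl q(3)]] .
      ultimately show ?thesis using nonneg_rpoly_add[OF q0(1) q(1)] by blast
    qed
    then show ?b by blast
  qed
  have ca: ?a if ?c
  proof -
    from that obtain N q where q: "q \<in> nonneg_rpoly" "Log q = ?L N" "poly_cong f q (r - 1)"
      by blast
    have "0 \<in> minkowski_multiple 0 (Log r)" by (simp add: minkowski_multiple_0)
    then have "0 \<in> Log q" unfolding q(2) by (intro UN_I[of 0]) simp_all
    then show ?a using positive_on_level_set[OF q(1) _ q(3)] by blast
  qed
  have bc: ?c if ?b
    using that by blast
  show ?thesis
  proof (intro conjI iffI)
    show ?b if ?a by (rule ab[OF that])
    show ?a if ?b by (rule ca[OF bc[OF that]])
    show ?c if ?b by (rule bc[OF that])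
    show ?b if ?c by (rule ab[OF ca[OF that]])
  qed
qed

end
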